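(* Let $h\in\mathcal{S}^*(\psi)$, let $\varphi\in\mathcal{B}_s$, let $g(z)=\varphi(z)h(z)$ for $z\in\mathbb{D}$, and let $f=h+\bar g$ be the corresponding harmonic mapping in $\mathbb{D}$. For $0<r<1$ put $m(r)=\min_{|z|=r}|\psi(z)|$. Let $r_\psi$ be the unique positive root in $(0,1)$ of the equation $$(1-r^2)m(r)-2r=0,$$ let $r_c$ be the radius of convexity of the class $\mathcal{S}^*(\psi)$, and let $R=\min\{r_\psi,r_c\}$. Then $f$ is sense-preserving and univalent in $\mathbb{D}_R$. Moreover, if $r_c\ge r_\psi$ and $m(r)=\psi(-r)$, then the result is sharp (i.e. $R$ cannot be replaced by any larger number for the whole family of such $f$).
   Context: $\mathbb{D}=\{z:|z|<1\}$ and $\mathbb{D}_r=\{z:|z|<r\}$. $\psi$ is a univalent analytic function in $\mathbb{D}$ with $\psi(z)=1+p_1z+p_2z^2+\cdots$ and $\Re\psi>0$ in $\mathbb{D}$; as a standing assumption its Taylor coefficients are positive. $\mathcal{A}$ is the class of analytic functions $h$ in $\mathbb{D}$ with $h(0)=0$, $h'(0)=1$. $\mathcal{S}^*(\psi)=\{h\in\mathcal{A}: zh'(z)/h(z)\prec\psi(z)\}$, where $\prec$ is subordination, i.e. $zh'(z)/h(z)=\psi(\omega(z))$ for some analytic $\omega:\mathbb{D}\to\mathbb{D}$ with $\omega(0)=0$. $\mathcal{B}_s$ is the class of analytic functions $\varphi:\mathbb{D}\to\mathbb{D}$. The radius of convexity $r_c$ of $\mathcal{S}^*(\psi)$ is the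 largest $\rho\in(0,1]$ such that every $h\in\mathcal{S}^*(\psi)$ maps $\mathbb{D}_\rho$ univalently onto a convex domain. A harmonic mapping $f=h+\bar g$ ($h,g$ analytic) is sense-preserving in a domain if $|h'|>|g'|$ there. *)

theory Defs
  imports "HOL-Complex_Analysis.Complex_Analysis"
begin

definition subordinate :: "(complex \<Rightarrow> complex) \<Rightarrow> (complex \<Rightarrow> complex) \<Rightarrow> bool" where
  "subordinate F G \<longleftrightarrow>
    (\<exists>\<omega>. \<omega> holomorphic_on ball 0 1 \<and> \<omega> ` ball 0 1 \<subseteq> ball 0 1 \<and> \<omega> 0 = 0 \<and>
         (\<forall>z\<in>ball 0 1. F z = G (\<omega> z)))"

definition normalized_analytic :: "(complex \<Rightarrow> complex) set" where
  "normalized_analytic = {h. h holomorphic_on ball 0 1 \<and> h 0 = 0 \<and> deriv h 0 = 1}"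

text \<open>For \<open>h\<close> with \<open>h 0 = 0\<close> and \<open>deriv h 0 = 1\<close> the quotient \<open>z h'(z) / h(z)\<close> has a removable
  singularity at \<open>0\<close>, and its value there is \<open>1\<close> (division by zero would give \<open>0\<close>).\<close>

definition starlike_quotient :: "(complex \<Rightarrow> complex) \<Rightarrow> complex \<Rightarrow> complex" where
  "starlike_quotient h z = (if z = 0 then 1 else z * deriv h z / h z)"

text \<open>The condition \<open>h z \<noteq> 0\<close> says that the quotient is defined on the punctured disc. It is
  implied by the subordination whenever \<open>\<psi>\<close> has no zero.\<close>

definition starlike_class :: "(complex \<Rightarrow> complex) \<Rightarrow> (complex \<Rightarrow> complex) set" where
  "starlike_class \<psi> =
    {h \<in> normalized_analytic.
       (\<forall>z\<in>ball 0 1 - {0}. h z \<noteq> 0) \<and> subordinate (starlike_quotient h) \<psi>}"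

definition schwarz_class :: "(complex \<Rightarrow> complex) set" where
  "schwarz_class = {\<phi>. \<phi> holomorphic_on ball 0 1 \<and> \<phi> ` ball 0 1 \<subseteq> ball 0 1}"

definition radius_of_convexity :: "(complex \<Rightarrow> complex) set \<Rightarrow> real" where
  "radius_of_convexity \<F> =
    (GREATEST \<rho>. 0 < \<rho> \<and> \<rho> \<le> 1 \<and>
       (\<forall>h\<in>\<F>. inj_on h (ball 0 \<rho>) \<and> convex (h ` ball 0 \<rho>)))"

definition circle_min :: "(complex \<Rightarrow> complex) \<Rightarrow> real \<Rightarrow> real" where
  "circle_min \<psi> r = (INF z\<in>sphere 0 r. cmod (\<psi> z))"

text \<open>The infimum is a minimum.\<close>

lemma circle_min_attained:
  assumes "continuous_on (sphere 0 r) \<psi>" and "0 \<le> r"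
  shows "\<exists>z\<in>sphere 0 r. circle_min \<psi> r = cmod (\<psi> z) \<and>
           (\<forall>w\<in>sphere 0 r. cmod (\<psi> z) \<le> cmod (\<psi> w))"
proof -
  have "complex_of_real r \<in> sphere 0 r"
    using assms(2) by simp
  then have "sphere 0 r \<noteq> ({} :: complex set)"
    by blast
  moreover have "continuous_on (sphere 0 r) (\<lambda>z. cmod (\<psi> z))"
    using assms(1) by (intro continuous_intros)
  ultimately obtain z where z: "z \<in> sphere 0 r" "\<forall>w\<in>sphere 0 r. cmod (\<psi> z) \<le> cmod (\<psi> w)"
    using continuous_attains_inf[OF compact_sphere] by blast
  then have "circle_min \<psi> r = cmod (\<psi> z)"
    unfolding circle_min_def by (intro cInf_eq_minimum) auto
  with z show ?thesis
    by blast
qed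

definition r_psi_root :: "(complex \<Rightarrow> complex) \<Rightarrow> real \<Rightarrow> bool" where
  "r_psi_root \<psi> r \<longleftrightarrow> 0 < r \<and> r < 1 \<and> (1 - r\<^sup>2) * circle_min \<psi> r - 2 * r = 0"

definition r_psi :: "(complex \<Rightarrow> complex) \<Rightarrow> real" where
  "r_psi \<psi> = (THE r. r_psi_root \<psi> r)"

definition harmonic_map :: "(complex \<Rightarrow> complex) \<Rightarrow> (complex \<Rightarrow> complex) \<Rightarrow> complex \<Rightarrow> complex" where
  "harmonic_map h g z = h z + cnj (g z)"

definition sense_preserving_on ::
    "(complex \<Rightarrow> complex) \<Rightarrow> (complex \<Rightarrow> complex) \<Rightarrow> complex set \<Rightarrow> bool" where
  "sense_preserving_on h g S \<longleftrightarrow> (\<forall>z\<in>S. cmod (deriv g z) < cmod (deriv h z))"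

end

theory Submission
  imports Defs
begin

text \<open>Let \<open>g = \<phi> * h\<close>. Since \<open>z * h' = \<psi> (\<omega> z) * h\<close> with \<open>cmod (\<omega> z) \<le> cmod z\<close>, the minimum principle
  bounds \<open>cmod (h / h')\<close> on the circle of radius \<open>r\<close> by \<open>r / m r\<close>. With the Schwarz-Pick bound for \<open>\<phi>'\<close> this
  gives \<open>cmod (g' / h') \<le> b + (1 - b\<^sup>2) * r / ((1 - r\<^sup>2) * m r)\<close>, \<open>b = cmod (\<phi> z)\<close>, which is below \<open>1\<close>
  when \<open>2 * r \<le> (1 - r\<^sup>2) * m r\<close>. Where moreover \<open>h\<close> is univalent with convex image, the map
  \<open>g \<circ> h\<inverse>\<close> is a strict contraction, so \<open>h + cnj g\<close> is injective; a disc inside the disc of convexity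
  again has convex image by Study's theorem. For sharpness take \<open>\<omega> = id\<close> and for \<open>\<phi>\<close> a disc
  automorphism with value close to \<open>1\<close> at \<open>- r\<close>, where both estimates are equalities. That the radius of
  convexity is a positive number needs a bound on \<open>h''\<close> uniform over the class: images of
  small discs are then convex because the discs are strictly convex.\<close>

subsection \<open>Schwarz-Pick, convex images and injectivity\<close>

lemma Moebius_function_has_field_derivative:
  assumes "1 - cnj w * z \<noteq> 0"
  shows "(Moebius_function 0 w has_field_derivative (1 - cnj w * w) / (1 - cnj w * z)\<^sup>2) (at z)"
  unfolding Moebius_function_simple[abs_def] using assms
  by (auto intro!: derivative_eq_intros simp: power2_eq_square algebra_simps)

lemma one_minus_norm_sq_pos:
  fixes z :: complex
  assumes "cmod z < 1"
  shows "0 < 1 - (cmod z)\<^sup>2"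
  using assms by (simp add: abs_square_less_1)

text \<open>Disc automorphisms on both sides move \<open>z\<close> and \<open>\<phi> z\<close> to
  the origin. The resulting self-map \<open>F\<close> fixes \<open>0\<close>, so Schwarz gives
  \<open>cmod (deriv F 0) \<le> 1\<close>, and the chain rule shows that \<open>deriv F 0\<close> is
  \<open>deriv \<phi> z\<close> times
  \<open>(1 - (cmod z)\<^sup>2) / (1 - (cmod b)\<^sup>2)\<close>.\<close>

lemma Schwarz_Pick_deriv:
  assumes hol: "\<phi> holomorphic_on ball 0 1" and im: "\<phi> ` ball 0 1 \<subseteq> ball 0 1" and z: "cmod z < 1"
  shows "cmod (deriv \<phi> z) \<le> (1 - (cmod (\<phi> z))\<^sup>2) / (1 - (cmod z)\<^sup>2)"
proof -
  define b where "b = \<phi> z"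
  have b: "cmod b < 1"
    using im z by (simp add: b_def image_subset_iff)
  define F where "F = Moebius_function 0 b \<circ> (\<phi> \<circ> Moebius_function 0 (-z))"
  have mz: "Moebius_function 0 (-z) holomorphic_on ball 0 1" "Moebius_function 0 (-z) ` ball 0 1 \<subseteq> ball 0 1"
    using z by (auto intro!: Moebius_function_holomorphic Moebius_function_norm_lt_1)
  have mb: "Moebius_function 0 b holomorphic_on ball 0 1" "Moebius_function 0 b ` ball 0 1 \<subseteq> ball 0 1"
    using b by (auto intro: Moebius_function_holomorphic Moebius_function_norm_lt_1)
  have m0: "Moebius_function 0 (-z) 0 = z"
    by (simp add: Moebius_function_simple)
  have holF: "F holomorphic_on ball 0 1"
    unfolding F_def using mz mb hol im
    by (intro holomorphic_on_compose_gen[where t = "ball 0 1"]) (auto simp: image_subset_iff)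
  have F0: "F 0 = 0"
    by (simp add: F_def m0 b_def Moebius_function_eq_zero)
  have F1: "cmod (F w) < 1" if "cmod w < 1" for w
    using that mz mb im by (auto simp: F_def image_subset_iff)
  have le1: "cmod (deriv F 0) \<le> 1"
    using Schwarz_Lemma(2)[OF holF F0, of 0] F1 by auto
  have pz: "0 < 1 - (cmod z)\<^sup>2" and pb: "0 < 1 - (cmod b)\<^sup>2"
    using one_minus_norm_sq_pos z b by blast+
  have cb: "1 - cnj b * b = of_real (1 - (cmod b)\<^sup>2)" and cz: "1 - cnj z * z = of_real (1 - (cmod z)\<^sup>2)"
    using complex_norm_square[of b] complex_norm_square[of z] by (simp_all add: mult.commute)
  have nb: "1 - cnj b * b \<noteq> 0"
    using pb unfolding cb by (metis less_irrefl of_real_eq_0_iff)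
  have "(\<phi> has_field_derivative deriv \<phi> z) (at z)"
    using hol z by (intro holomorphic_derivI[of _ "ball 0 1"]) auto
  moreover have "(Moebius_function 0 b has_field_derivative (1 - cnj b * b) / (1 - cnj b * b)\<^sup>2) (at b)"
    using nb by (intro Moebius_function_has_field_derivative) auto
  moreover have "(Moebius_function 0 (-z) has_field_derivative
      (1 - cnj (-z) * (-z)) / (1 - cnj (-z) * 0)\<^sup>2) (at 0)"
    by (intro Moebius_function_has_field_derivative) auto
  ultimately have "(F has_field_derivative ((1 - cnj b * b) / (1 - cnj b * b)\<^sup>2 * (deriv \<phi> z *
      ((1 - cnj (-z) * (-z)) / (1 - cnj (-z) * 0)\<^sup>2)))) (at 0)"
    unfolding F_def using m0 by (intro DERIV_chain) (simp_all add: b_def)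
  then have "deriv F 0 = deriv \<phi> z * of_real ((1 - (cmod z)\<^sup>2) / (1 - (cmod b)\<^sup>2))"
    using nb DERIV_imp_deriv by (fastforce simp: power2_eq_square cb cz simp flip: of_real_mult)
  then have "cmod (deriv F 0) = cmod (deriv \<phi> z) * ((1 - (cmod z)\<^sup>2) / (1 - (cmod b)\<^sup>2))"
    using pz pb by (simp only: norm_mult norm_of_real) simp
  with le1 pz pb show ?thesis
    by (simp add: b_def field_simps)
qed

lemma Schwarz_Lemma_ball:
  assumes hol: "f holomorphic_on ball 0 r" and f0: "f 0 = 0" and im: "f ` ball 0 r \<subseteq> ball 0 r"
    and z: "cmod z < r"
  shows "cmod (f z) \<le> cmod z"
proof -
  have r: "0 < r"
    using z by (meson norm_ge_zero order.strict_trans1)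
  have im': "cmod (f w) < r" if "cmod w < r" for w
    using im that by (auto simp: image_subset_iff)
  define F where "F w = f (of_real r * w) / of_real r" for w
  have "f \<circ> (\<lambda>w. of_real r * w) holomorphic_on ball 0 1"
    using r by (intro holomorphic_on_compose_gen[OF _ hol] holomorphic_intros) (auto simp: norm_mult)
  then have holF: "F holomorphic_on ball 0 1"
    unfolding F_def using r by (intro holomorphic_intros) (auto simp: o_def)
  have F1: "cmod (F w) < 1" if "cmod w < 1" for w
    using r that im'[of "of_real r * w"] by (simp add: F_def norm_divide norm_mult)
  have "cmod (F (z / of_real r)) \<le> cmod (z / of_real r)"
    using z r by (intro Schwarz_Lemma(1)[OF holF _ F1]) (auto simp: F_def f0 norm_divide)
  then show ?thesis
    using r by (simp add: F_def norm_divide divide_le_cancel)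
qed

text \<open>Study's theorem. For \<open>cmod x \<le> cmod y\<close> and \<open>q = x / y\<close>,
  the map \<open>G z = u *\<^sub>R h (q * z) + v *\<^sub>R h z\<close> stays in the convex image of
  the large disc and agrees with \<open>h\<close> at \<open>0\<close>. Hence
  \<open>k \<circ> G\<close>, with \<open>k\<close> the inverse of \<open>h\<close>, is a self-map
  of that disc fixing \<open>0\<close>. The Schwarz lemma at \<open>y\<close> puts
  \<open>k (G y)\<close> in the small disc, and \<open>G y\<close> is the given convex
  combination.\<close>

lemma convex_image_subball:
  assumes hol: "h holomorphic_on ball 0 \<rho>" and inj: "inj_on h (ball 0 \<rho>)"
    and conv: "convex (h ` ball 0 \<rho>)" and "r \<le> \<rho>"
  shows "convex (h ` ball 0 r)"
proof -
  obtain k where k: "k holomorphic_on (h ` ball 0 \<rho>)" "\<And>z. z \<in> ball 0 \<rho> \<Longrightarrow> k (h z) = z"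
    using holomorphic_has_inverse[OF hol open_ball inj] by metis
  have *: "u *\<^sub>R h x + v *\<^sub>R h y \<in> h ` ball 0 r"
    if x: "cmod x \<le> cmod y" and y: "cmod y < r" and uv: "0 \<le> u" "0 \<le> v" "u + v = 1" for x y u v
  proof (cases "y = 0")
    case True
    with x have "x = 0" by simp
    with True y uv show ?thesis
      by (metis (no_types, lifting) imageI mem_ball_0 scaleR_left_distrib scaleR_one)
  next
    case False
    define q where "q = x / y"
    have q: "cmod q \<le> 1"
      using False x by (simp add: q_def norm_divide)
    have qz: "q * z \<in> ball 0 \<rho>" if "z \<in> ball 0 \<rho>" for z
      using that mult_left_le_one_le[OF _ _ q, of "cmod z"] by (auto simp: norm_mult)
    define G where "G z = u *\<^sub>R h (q * z) + v *\<^sub>R h z" for z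
    have G: "G z \<in> h ` ball 0 \<rho>" if "z \<in> ball 0 \<rho>" for z
      unfolding G_def using conv that qz[OF that] uv by (intro convexD) auto
    have holG: "G holomorphic_on ball 0 \<rho>"
      unfolding G_def scaleR_conv_of_real
      by (intro holomorphic_intros hol holomorphic_on_compose_gen[OF _ hol, unfolded o_def])
         (use qz in auto)
    have hk: "h (k w) = w \<and> k w \<in> ball 0 \<rho>" if "w \<in> h ` ball 0 \<rho>" for w
      using that k(2) by auto
    have G0: "G 0 = h 0"
      using uv by (simp add: G_def flip: scaleR_left_distrib)
    have \<rho>: "0 \<in> ball 0 \<rho>" and y\<rho>: "cmod y < \<rho>"
      using y \<open>r \<le> \<rho>\<close> le_less_trans[OF norm_ge_zero y] by auto
    have "cmod ((k \<circ> G) y) \<le> cmod y"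
    proof (rule Schwarz_Lemma_ball[where r = \<rho>])
      show "k \<circ> G holomorphic_on ball 0 \<rho>"
        using G by (intro holomorphic_on_compose_gen[OF holG k(1)]) auto
      show "(k \<circ> G) 0 = 0"
        using G0 k(2)[OF \<rho>] by simp
      show "(k \<circ> G) ` ball 0 \<rho> \<subseteq> ball 0 \<rho>"
        using hk G by auto
    qed (use y\<rho> in auto)
    then have "k (G y) \<in> ball 0 r"
      using y by simp
    moreover have "h (k (G y)) = G y"
      using hk G y\<rho> by simp
    ultimately have "G y \<in> h ` ball 0 r"
      by (metis imageI)
    then show ?thesis
      using False by (simp add: G_def q_def)
  qed
  show ?thesis
  proof (rule convexI, clarify)
    fix x y :: complex and u v :: real
    assume "x \<in> ball 0 r" "y \<in> ball 0 r" and uv: "0 \<le> u" "0 \<le> v" "u + v = 1"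
    then show "u *\<^sub>R h x + v *\<^sub>R h y \<in> h ` ball 0 r"
      using *[of x y u v] *[of y x v u] by (cases "cmod x \<le> cmod y") (auto simp: add.commute)
  qed
qed

text \<open>In the coordinate \<open>w = h z\<close> the map becomes \<open>w + cnj (G w)\<close>, where \<open>G\<close> is strictly
  contracting on segments of the convex image.\<close>

lemma inj_on_harmonic_map_convex:
  assumes S: "open S" and h: "h holomorphic_on S" "inj_on h S" "convex (h ` S)"
    and g: "g holomorphic_on S" and sp: "sense_preserving_on h g S"
  shows "inj_on (harmonic_map h g) S"
proof -
  obtain k where k: "k holomorphic_on (h ` S)" "\<And>z. z \<in> S \<Longrightarrow> deriv h z * deriv k (h z) = 1"
      "\<And>z. z \<in> S \<Longrightarrow> k (h z) = z"
    using holomorphic_has_inverse[OF h(1) S h(2)] by metis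
  define T where "T = h ` S"
  have T: "open T" "convex T"
    using open_mapping_thm3[OF h(1) S h(2)] h(3) by (simp_all add: T_def)
  define G where "G = g \<circ> k"
  have kT: "k w \<in> S" if "w \<in> T" for w
    using that k(3) by (auto simp: T_def)
  have holG: "G holomorphic_on T"
    unfolding G_def using k(1) g kT by (intro holomorphic_on_compose_gen[where t = S]) (auto simp: T_def)
  have dG: "cmod (deriv G w) < 1" if w: "w \<in> T" for w
  proof -
    obtain z where z: "z \<in> S" "w = h z"
      using w unfolding T_def by blast
    have "deriv G w = deriv g (k w) * deriv k w"
      unfolding G_def using k(1) g kT[OF w] w T(1) S
      by (intro deriv_chain) (auto simp: T_def intro: holomorphic_on_imp_differentiable_at)
    moreover have "deriv k w = 1 / deriv h z" and "deriv h z \<noteq> 0"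
      using k(2)[OF z(1)] z(2) by (auto simp: eq_divide_eq mult.commute)
    ultimately show ?thesis
      using sp z k(3) by (auto simp: sense_preserving_on_def norm_mult norm_divide)
  qed
  show ?thesis
  proof (rule inj_onI, rule ccontr)
    fix x y assume xy: "x \<in> S" "y \<in> S" "harmonic_map h g x = harmonic_map h g y" "x \<noteq> y"
    define C where "C = closed_segment (h x) (h y)"
    have C: "C \<subseteq> T" "compact C" "convex C" "C \<noteq> {}"
      using xy T by (auto simp: C_def T_def closed_segment_subset)
    have "continuous_on C (\<lambda>w. cmod (deriv G w))"
      using holomorphic_deriv[OF holG T(1)] C(1)
      by (intro continuous_on_norm) (meson continuous_on_subset holomorphic_on_imp_continuous_on)
    \<comment> \<open>Pointwise \<open>cmod (deriv G w) < 1\<close> gives no uniform constant on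
      \<open>T\<close>. On the compact segment the maximum is attained, which makes it a Lipschitz
      constant below \<open>1\<close>.\<close>
    then obtain m where m: "m \<in> C" "\<And>w. w \<in> C \<Longrightarrow> cmod (deriv G w) \<le> cmod (deriv G m)"
      using continuous_attains_sup[OF C(2,4)] by blast
    have "cmod (G (h x) - G (h y)) \<le> cmod (deriv G m) * cmod (h x - h y)"
    proof (rule field_differentiable_bound[where S = C and f' = "deriv G"])
      fix w assume "w \<in> C"
      then show "(G has_field_derivative deriv G w) (at w within C)"
        using C(1) holG T(1) by (meson has_field_derivative_at_within holomorphic_derivI subsetD)
    qed (use C m in \<open>auto simp: C_def\<close>)
    moreover have "h x - h y \<noteq> 0"
      using xy h(2) by (auto dest: inj_onD)
    then have "cmod (deriv G m) * cmod (h x - h y) < cmod (h x - h y)"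
      using dG m(1) C(1) by auto
    moreover have "h x - h y = - cnj (g x - g y)"
      using xy(3) by (simp add: harmonic_map_def algebra_simps)
    then have "cmod (h x - h y) = cmod (g x - g y)"
      by (metis complex_mod_cnj norm_minus_cancel)
    ultimately show False
      using k(3) xy by (simp add: G_def)
  qed
qed

subsection \<open>Convexity of images of small discs\<close>

text \<open>The mean value inequality is applied twice: to \<open>deriv h\<close> on
  \<open>S\<close>, then to \<open>h z - deriv h c * z\<close> on the segment from \<open>c\<close>
  to \<open>x\<close>.\<close>

lemma holomorphic_linear_approx:
  assumes S: "open S" "convex S" and hol: "h holomorphic_on S" and c: "c \<in> S" and x: "x \<in> S"
    and B: "\<And>z. z \<in> S \<Longrightarrow> cmod (deriv (deriv h) z) \<le> B"
  shows "cmod (h x - h c - deriv h c * (x - c)) \<le> B * (cmod (x - c))\<^sup>2"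
proof -
  define C where "C = closed_segment c x"
  have C: "C \<subseteq> S" "convex C" "c \<in> C" "x \<in> C"
    using S c x by (auto simp: C_def closed_segment_subset)
  have B0: "0 \<le> B"
    using order_trans[OF norm_ge_zero B[OF c]] .
  have d1: "cmod (deriv h z - deriv h c) \<le> B * cmod (z - c)" if "z \<in> S" for z
  proof (rule field_differentiable_bound[OF S(2)])
    fix w assume "w \<in> S"
    then show "(deriv h has_field_derivative deriv (deriv h) w) (at w within S)"
      using holomorphic_deriv[OF hol S(1)] S(1)
      by (meson has_field_derivative_at_within holomorphic_derivI)
  qed (use that c B in auto)
  have "cmod ((h x - deriv h c * x) - (h c - deriv h c * c)) \<le> (B * cmod (x - c)) * cmod (x - c)"
  proof (rule field_differentiable_bound[OF C(2), where f' = "\<lambda>z. deriv h z - deriv h c"])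
    fix w assume w: "w \<in> C"
    have "(h has_field_derivative deriv h w) (at w within C)"
      using C(1) w hol S(1) by (meson has_field_derivative_at_within holomorphic_derivI subsetD)
    then show "((\<lambda>z. h z - deriv h c * z) has_field_derivative deriv h w - deriv h c) (at w within C)"
      by (auto intro!: derivative_eq_intros)
    have "cmod (w - c) \<le> cmod (x - c)"
      using w segment_bound(1)[of w c x] by (simp add: C_def)
    then show "cmod (deriv h w - deriv h c) \<le> B * cmod (x - c)"
      using d1[of w] w C(1) B0 by (meson mult_left_mono order_trans subsetD)
  qed (use C in auto)
  then show ?thesis
    by (simp add: algebra_simps power2_eq_square)
qed

text \<open>Strict convexity of the disc in quantitative form: the deficit
  \<open>u * v * (norm (x - y))\<^sup>2\<close> is the room left around an interior point of a
  chord.\<close>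

lemma norm_convex_combination_sq:
  fixes x y :: "'a::real_inner"
  assumes "u + v = 1"
  shows "(norm (u *\<^sub>R x + v *\<^sub>R y))\<^sup>2 = u * (norm x)\<^sup>2 + v * (norm y)\<^sup>2 - u * v * (norm (x - y))\<^sup>2"
proof -
  have v: "v = 1 - u" using assms by simp
  show ?thesis
    unfolding power2_norm_eq_inner v
    by (simp add: inner_add_left inner_add_right inner_diff_left inner_diff_right inner_commute
        algebra_simps power2_eq_square)
qed

text \<open>Fixed point of the contraction \<open>\<zeta> \<mapsto> \<zeta> + w - h \<zeta>\<close>.\<close>

lemma cball_subset_image_near_identity:
  assumes sub: "cball c s \<subseteq> S" and S: "open S" and hol: "h holomorphic_on S"
    and d: "\<And>z. z \<in> S \<Longrightarrow> cmod (deriv h z - 1) \<le> 1/2" and "0 \<le> s"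
  shows "cball (h c) (s/2) \<subseteq> h ` cball c s"
proof
  fix w assume w: "w \<in> cball (h c) (s/2)"
  define T where "T z = z + w - h z" for z
  have lip: "cmod (T x - T y) \<le> 1/2 * cmod (x - y)" if "x \<in> cball c s" "y \<in> cball c s" for x y
  proof (rule field_differentiable_bound[where S = "cball c s" and f' = "\<lambda>z. 1 - deriv h z"])
    fix z assume z: "z \<in> cball c s"
    have "(h has_field_derivative deriv h z) (at z within cball c s)"
      using z sub hol S by (meson has_field_derivative_at_within holomorphic_derivI subsetD)
    then show "(T has_field_derivative 1 - deriv h z) (at z within cball c s)"
      unfolding T_def by (auto intro!: derivative_eq_intros)
    show "cmod (1 - deriv h z) \<le> 1/2"
      using d[of z] z sub by (auto simp: norm_minus_commute)
  qed (use that in auto)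
  have "\<exists>!z\<in>cball c s. T z = z"
  proof (rule Banach_fix[where c = "1/2"])
    show "T ` cball c s \<subseteq> cball c s"
    proof clarify
      fix z assume z: "z \<in> cball c s"
      have "cmod (T z - c) \<le> cmod (T z - T c) + cmod (T c - c)"
        using norm_triangle_ineq[of "T z - T c" "T c - c"] by simp
      also have "cmod (T c - c) \<le> s/2"
        using w by (simp add: T_def dist_norm norm_minus_commute)
      also have "cmod (T z - T c) \<le> s/2"
        using lip[OF z, of c] z \<open>0 \<le> s\<close> by (simp add: dist_norm norm_minus_commute)
      finally show "T z \<in> cball c s"
        by (simp add: dist_norm norm_minus_commute)
    qed
  qed (use lip \<open>0 \<le> s\<close> in \<open>auto simp: dist_norm complete_eq_closed\<close>)
  then obtain z where "z \<in> cball c s" "T z = z" by blast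
  then show "w \<in> h ` cball c s"
    by (auto simp: T_def)
qed

text \<open>For a chord of length \<open>d\<close> the image \<open>h c\<close> of a convex combination with weights \<open>u, v\<close>
  misses the combination of the images by at most \<open>B * u * v * d\<^sup>2\<close>, while the disc still contains
  a ball of radius \<open>u * v * d\<^sup>2 / (2 * \<rho>)\<close> around \<open>c\<close>.\<close>

lemma small_disc_image_convex:
  assumes hol: "h holomorphic_on ball 0 \<rho>" and h1: "deriv h 0 = 1"
    and B: "\<And>z. z \<in> ball 0 \<rho> \<Longrightarrow> cmod (deriv (deriv h) z) \<le> B"
    and \<rho>: "0 < \<rho>" "4 * B * \<rho> \<le> 1"
  shows "inj_on h (ball 0 \<rho>)" and "convex (h ` ball 0 \<rho>)"
proof -
  have B0: "0 \<le> B"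
    using order_trans[OF norm_ge_zero B[of 0]] \<rho> by simp
  have d: "cmod (deriv h z - 1) \<le> 1/2" if z: "z \<in> ball 0 \<rho>" for z
  proof -
    have "cmod (deriv h z - deriv h 0) \<le> B * cmod (z - 0)"
    proof (rule field_differentiable_bound[OF convex_ball])
      fix w :: complex assume "w \<in> ball 0 \<rho>"
      then show "(deriv h has_field_derivative deriv (deriv h) w) (at w within ball 0 \<rho>)"
        using holomorphic_deriv[OF hol open_ball]
        by (meson has_field_derivative_at_within holomorphic_derivI open_ball)
    qed (use z \<rho> B in auto)
    also have "\<dots> \<le> B * \<rho>"
      using z B0 by (intro mult_left_mono) auto
    finally show ?thesis
      using \<rho> h1 by simp
  qed
  show "inj_on h (ball 0 \<rho>)"
  proof (rule inj_onI)
    fix x y assume xy: "x \<in> ball 0 \<rho>" "y \<in> ball 0 \<rho>" "h x = h y"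
    \<comment> \<open>Since \<open>h\<close> minus the identity has Lipschitz constant
      \<open>1/2\<close>, \<open>h x = h y\<close> would give
      \<open>cmod (x - y) \<le> cmod (x - y) / 2\<close>.\<close>
    have "cmod ((h x - x) - (h y - y)) \<le> 1/2 * cmod (x - y)"
    proof (rule field_differentiable_bound[OF convex_ball, where f' = "\<lambda>z. deriv h z - 1"])
      fix z :: complex assume z: "z \<in> ball 0 \<rho>"
      have "(h has_field_derivative deriv h z) (at z within ball 0 \<rho>)"
        using z hol by (meson has_field_derivative_at_within holomorphic_derivI open_ball)
      then show "((\<lambda>z. h z - z) has_field_derivative deriv h z - 1) (at z within ball 0 \<rho>)"
        by (auto intro!: derivative_eq_intros)
    qed (use xy d in auto)
    with xy show "x = y"
      by (simp add: norm_minus_commute)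
  qed
  show "convex (h ` ball 0 \<rho>)"
  proof (rule convexI, clarify)
    fix x y :: complex and u v :: real
    assume xy: "x \<in> ball 0 \<rho>" "y \<in> ball 0 \<rho>" and uv: "0 \<le> u" "0 \<le> v" "u + v = 1"
    define c where "c = u *\<^sub>R x + v *\<^sub>R y"
    define D where "D = u * v * (cmod (x - y))\<^sup>2"
    define s where "s = D / (2 * \<rho>)"
    have c: "c \<in> ball 0 \<rho>"
      unfolding c_def using xy uv by (intro convexD[OF convex_ball]) auto
    have D0: "0 \<le> D"
      using uv by (simp add: D_def)
    have s0: "0 \<le> s" and sD: "2 * \<rho> * s = D"
      using \<rho> D0 by (auto simp: s_def)
    have xc: "x - c = of_real v * (x - y)" and yc: "y - c = - of_real u * (x - y)"
    proof -
      have u: "of_real u = 1 - (of_real v :: complex)" and v: "of_real v = 1 - (of_real u :: complex)"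
        using uv by (simp_all add: eq_diff_eq add.commute flip: of_real_add)
      show "x - c = of_real v * (x - y)"
        unfolding c_def scaleR_conv_of_real u by (simp add: algebra_simps)
      show "y - c = - of_real u * (x - y)"
        unfolding c_def scaleR_conv_of_real v by (simp add: algebra_simps)
    qed
    have sx: "(cmod x)\<^sup>2 < \<rho>\<^sup>2" "(cmod y)\<^sup>2 < \<rho>\<^sup>2"
      using xy by (auto intro!: power_strict_mono)
    have cD: "(cmod c)\<^sup>2 = u * (cmod x)\<^sup>2 + v * (cmod y)\<^sup>2 - D"
      using norm_convex_combination_sq[OF uv(3), of x y] by (simp add: c_def D_def)
    have lt: "u * (cmod x)\<^sup>2 + v * (cmod y)\<^sup>2 < \<rho>\<^sup>2"
      using convexD_alt[of "{..<\<rho>\<^sup>2}" "(cmod x)\<^sup>2" "(cmod y)\<^sup>2" v] sx uv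
      by (auto simp: convex_real_interval eq_diff_eq[symmetric])
    have "D < \<rho>\<^sup>2"
      using cD lt zero_le_power2[of "cmod c"] by linarith
    then have s\<rho>: "s < \<rho>"
      using \<rho> D0 by (simp add: s_def power2_eq_square field_simps)
    \<comment> \<open>By the choice of \<open>s\<close>,
      \<open>\<rho>\<^sup>2 - D = \<rho>\<^sup>2 - 2 * \<rho> * s\<close>, which is at most
      \<open>(\<rho> - s)\<^sup>2\<close>.\<close>
    have "(cmod c)\<^sup>2 < (\<rho> - s)\<^sup>2"
      using cD lt sD zero_le_power2[of s] unfolding power2_diff by linarith
    then have cs: "cmod c < \<rho> - s"
      by (rule power_less_imp_less_base) (use s\<rho> in auto)
    have sub: "cball c s \<subseteq> ball 0 \<rho>"
    proof
      fix z assume "z \<in> cball c s"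
      then have "cmod (z - c) \<le> s" by (simp add: dist_norm norm_minus_commute)
      then show "z \<in> ball 0 \<rho>"
        using cs norm_triangle_sub[of z c] by simp
    qed
    define e where "e z = h z - h c - deriv h c * (z - c)" for z
    have e: "cmod (e z) \<le> B * (cmod (z - c))\<^sup>2" if "z \<in> ball 0 \<rho>" for z
      unfolding e_def using hol c that B by (intro holomorphic_linear_approx[of "ball 0 \<rho>"]) auto
    \<comment> \<open>The first-order terms at \<open>c\<close> cancel in the convex combination, so
      only the quadratic errors \<open>e x\<close> and \<open>e y\<close> survive.\<close>
    have "u *\<^sub>R (x - c) + v *\<^sub>R (y - c) = 0"
      by (simp add: xc yc scaleR_conv_of_real algebra_simps)
    then have lin: "deriv h c * (u *\<^sub>R (x - c) + v *\<^sub>R (y - c)) = 0"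
      by simp
    have hc: "u *\<^sub>R h c + v *\<^sub>R h c = h c"
      using uv by (simp flip: scaleR_left_distrib)
    have "u *\<^sub>R h x + v *\<^sub>R h y - h c = u *\<^sub>R e x + v *\<^sub>R e y"
      using lin hc by (simp add: e_def algebra_simps)
    then have "cmod (u *\<^sub>R h x + v *\<^sub>R h y - h c) \<le> u * cmod (e x) + v * cmod (e y)"
      using norm_triangle_ineq[of "u *\<^sub>R e x" "v *\<^sub>R e y"] uv by simp
    also have "\<dots> \<le> u * (B * (cmod (x - c))\<^sup>2) + v * (B * (cmod (y - c))\<^sup>2)"
      using e xy uv by (intro add_mono mult_left_mono) auto
    also have "\<dots> = B * (u * v * (u + v) * (cmod (x - y))\<^sup>2)"
      unfolding xc yc norm_mult power_mult_distrib norm_minus_cancel norm_of_real power2_abs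
      by (simp add: algebra_simps power2_eq_square)
    also have "\<dots> = (4 * B * \<rho>) * (s / 2)"
      using uv sD by (simp add: D_def)
    also have "\<dots> \<le> s / 2"
      using mult_right_mono[OF \<rho>(2), of "s/2"] s0 by simp
    finally have "u *\<^sub>R h x + v *\<^sub>R h y \<in> cball (h c) (s/2)"
      by (simp add: dist_norm norm_minus_commute)
    then show "u *\<^sub>R h x + v *\<^sub>R h y \<in> h ` ball 0 \<rho>"
      using cball_subset_image_near_identity[OF sub open_ball hol d s0] sub by blast
  qed
qed

subsection \<open>The radius of convexity of the starlike class\<close>

text \<open>\<open>Q\<close> is the primitive of \<open>(p z - 1) / z\<close> vanishing at
  \<open>0\<close>. The singularity is removable, with value \<open>deriv p 0\<close>. The lemma
  serves both to represent members of the class and to construct one.\<close>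

lemma starlike_exponent:
  assumes hol: "p holomorphic_on ball 0 1" and p0: "p 0 = 1"
  obtains Q where "Q holomorphic_on ball 0 1" "Q 0 = 0" "deriv Q 0 = deriv p 0"
    "\<And>z. z \<in> ball 0 1 \<Longrightarrow> z * deriv Q z = p z - 1"
proof -
  define q where "q z = (if z = 0 then deriv p 0 else (p z - p 0) / (z - 0))" for z
  have "q holomorphic_on ball 0 1"
    unfolding q_def using pole_lemma_open[OF hol open_ball] .
  then obtain g where g: "\<And>x. x \<in> ball 0 1 \<Longrightarrow> (g has_field_derivative q x) (at x within ball 0 1)"
    using holomorphic_convex_primitive'[OF convex_ball open_ball] by metis
  have g': "(g has_field_derivative q x) (at x)" if "x \<in> ball 0 1" for x
    using g[OF that] that by (simp add: at_within_open[OF _ open_ball])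
  have d: "((\<lambda>z. g z - g 0) has_field_derivative q x) (at x)" if "x \<in> ball 0 1" for x
    using g'[OF that] by (auto intro!: derivative_eq_intros)
  show ?thesis
  proof
    show "(\<lambda>z. g z - g 0) holomorphic_on ball 0 1"
      using d by (meson field_differentiable_at_within field_differentiable_def holomorphic_on_def)
    show "deriv (\<lambda>z. g z - g 0) 0 = deriv p 0"
      using DERIV_imp_deriv[OF d[of 0]] by (simp add: q_def)
    show "z * deriv (\<lambda>z. g z - g 0) z = p z - 1" if "z \<in> ball 0 1" for z
      using DERIV_imp_deriv[OF d[OF that]] p0 by (simp add: q_def)
  qed simp
qed

text \<open>Write \<open>h z = z * k z\<close>. Off the origin the equation reduces to
  \<open>deriv k x = deriv Q x * k x\<close>, so \<open>k z * exp (- Q z)\<close> has derivative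
  \<open>0\<close> there. By continuity it is constant on the whole disc, with value
  \<open>deriv h 0 = 1\<close>.\<close>

lemma starlike_eq_exp:
  assumes h: "h holomorphic_on ball 0 1" "h 0 = 0" "deriv h 0 = 1"
    and Q: "Q holomorphic_on ball 0 1" "Q 0 = 0"
    and eq: "\<And>z. z \<in> ball 0 1 \<Longrightarrow> z * deriv h z = (1 + z * deriv Q z) * h z"
    and z: "z \<in> ball 0 1"
  shows "h z = z * exp (Q z)"
proof -
  obtain k where k: "k holomorphic_on ball 0 1" "\<And>z. cmod z < 1 \<Longrightarrow> h z = z * k z" "deriv h 0 = k 0"
    using Schwarz3[OF h(1,2)] by metis
  define v where "v z = k z * exp (- Q z)" for z
  have "\<exists>c. \<forall>x\<in>ball 0 1. v x = c"
  proof (rule DERIV_zero_connected_constant[where S = "ball 0 1" and K = "{0}"])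
    show "continuous_on (ball 0 1) v"
      unfolding v_def using k(1) Q(1)
      by (intro continuous_intros holomorphic_on_imp_continuous_on)
    show "\<forall>x\<in>ball 0 1 - {0}. (v has_field_derivative 0) (at x)"
    proof
      fix x :: complex assume "x \<in> ball 0 1 - {0}"
      then have x: "x \<in> ball 0 1" "x \<noteq> 0" by auto
      have dk: "(k has_field_derivative deriv k x) (at x)" and dQ: "(Q has_field_derivative deriv Q x) (at x)"
        using k(1) Q(1) x(1) by (auto intro: holomorphic_derivI[OF _ open_ball])
      have "((\<lambda>z. z * k z) has_field_derivative k x + x * deriv k x) (at x)"
        using dk by (auto intro!: derivative_eq_intros)
      then have "(h has_field_derivative k x + x * deriv k x) (at x)"
        by (rule has_field_derivative_transform_within_open[OF _ open_ball x(1)]) (simp add: k(2))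
      then have "x * (k x + x * deriv k x) = (1 + x * deriv Q x) * (x * k x)"
        using eq[OF x(1)] k(2) x(1) DERIV_imp_deriv by fastforce
      then have "deriv k x = deriv Q x * k x"
        using x(2) by (simp add: algebra_simps)
      then show "(v has_field_derivative 0) (at x)"
        unfolding v_def using dk dQ by (auto intro!: derivative_eq_intros)
    qed
  qed auto
  then have "v z = v 0"
    using z by (metis centre_in_ball zero_less_one)
  then have "k z * exp (- Q z) = 1"
    using k(3) h(3) Q(2) by (simp add: v_def)
  then show ?thesis
    using k(2) z by (simp add: exp_minus field_simps)
qed

text \<open>Multiplying out the quotient gives an equation that also holds at \<open>0\<close>,
  where both sides vanish. The bound on \<open>\<omega>\<close> is the Schwarz lemma.\<close>

lemma starlike_classE:
  assumes "h \<in> starlike_class \<psi>"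
  obtains \<omega> where "h holomorphic_on ball 0 1" "h 0 = 0" "deriv h 0 = 1"
    "\<And>z. z \<in> ball 0 1 \<Longrightarrow> z \<noteq> 0 \<Longrightarrow> h z \<noteq> 0"
    "\<omega> holomorphic_on ball 0 1" "\<And>z. z \<in> ball 0 1 \<Longrightarrow> \<omega> z \<in> ball 0 1" "\<omega> 0 = 0"
    "\<And>z. z \<in> ball 0 1 \<Longrightarrow> cmod (\<omega> z) \<le> cmod z"
    "\<And>z. z \<in> ball 0 1 \<Longrightarrow> z * deriv h z = \<psi> (\<omega> z) * h z"
proof -
  have h: "h holomorphic_on ball 0 1" "h 0 = 0" "deriv h 0 = 1" "\<And>z. z \<in> ball 0 1 \<Longrightarrow> z \<noteq> 0 \<Longrightarrow> h z \<noteq> 0"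
    using assms by (auto simp: starlike_class_def normalized_analytic_def)
  obtain \<omega> where w: "\<omega> holomorphic_on ball 0 1" "\<omega> ` ball 0 1 \<subseteq> ball 0 1" "\<omega> 0 = 0"
      "\<And>z. z \<in> ball 0 1 \<Longrightarrow> starlike_quotient h z = \<psi> (\<omega> z)"
    using assms by (auto simp: starlike_class_def subordinate_def)
  have "cmod (\<omega> z) \<le> cmod z" if "z \<in> ball 0 1" for z
    using Schwarz_Lemma(1)[OF w(1,3), of z] w(2) that by (auto simp: image_subset_iff)
  moreover have "z * deriv h z = \<psi> (\<omega> z) * h z" if "z \<in> ball 0 1" for z
    using w(4)[OF that] h(2) h(4)[OF that] by (cases "z = 0") (auto simp: starlike_quotient_def field_simps)
  ultimately show ?thesis
    using that[of \<omega>] h w by (auto simp: image_subset_iff)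
qed

text \<open>The member of the class belonging to \<open>\<omega> = id\<close>, obtained as
  \<open>z * exp (Q z)\<close> with \<open>z * deriv Q z = \<psi> z - 1\<close>. It is the extremal
  \<open>h\<close> for sharpness.\<close>

lemma exists_starlike:
  assumes hol: "\<psi> holomorphic_on ball 0 1" and \<psi>0: "\<psi> 0 = 1"
  obtains h where "h \<in> starlike_class \<psi>" "\<And>z. z \<in> ball 0 1 \<Longrightarrow> z * deriv h z = \<psi> z * h z"
proof -
  obtain Q where Q: "Q holomorphic_on ball 0 1" "Q 0 = 0"
      "\<And>z. z \<in> ball 0 1 \<Longrightarrow> z * deriv Q z = \<psi> z - 1"
    using starlike_exponent[OF hol \<psi>0] by metis
  define h where "h z = z * exp (Q z)" for z
  have d: "(h has_field_derivative (1 + z * deriv Q z) * exp (Q z)) (at z)" if "z \<in> ball 0 1" for z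
  proof -
    have "(Q has_field_derivative deriv Q z) (at z)"
      using Q(1) that by (auto intro: holomorphic_derivI[OF _ open_ball])
    then show ?thesis
      unfolding h_def by (auto intro!: derivative_eq_intros simp: algebra_simps)
  qed
  have dh: "deriv h z = (1 + z * deriv Q z) * exp (Q z)" if "z \<in> ball 0 1" for z
    using d[OF that] by (rule DERIV_imp_deriv)
  have eq: "z * deriv h z = \<psi> z * h z" if "z \<in> ball 0 1" for z
    using dh[OF that] Q(3)[OF that] by (simp add: h_def)
  have hol_h: "h holomorphic_on ball 0 1"
    using d by (meson field_differentiable_at_within field_differentiable_def holomorphic_on_def)
  have "starlike_quotient h z = \<psi> z" if "z \<in> ball 0 1" for z
    using eq[OF that] \<psi>0 by (auto simp: starlike_quotient_def h_def)
  then have "subordinate (starlike_quotient h) \<psi>"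
    unfolding subordinate_def by (intro exI[of _ "\<lambda>z. z"]) auto
  then have "h \<in> starlike_class \<psi>"
    using hol_h dh[of 0] Q(2) by (simp add: starlike_class_def normalized_analytic_def h_def)
  with eq show ?thesis
    using that by blast
qed

text \<open>The bound on \<open>h''\<close> is uniform in \<open>h\<close>: writing \<open>h z = z * exp (Q z)\<close>, the derivative of
  \<open>Q\<close> is \<open>(\<psi> (\<omega> z) - 1) / z\<close>, and \<open>cmod (\<psi> w - 1) \<le> L * cmod w\<close> with
  \<open>cmod (\<omega> z) \<le> cmod z\<close>.\<close>

lemma starlike_class_deriv2_bounded:
  assumes hol: "\<psi> holomorphic_on ball 0 1" and \<psi>0: "\<psi> 0 = 1"
  obtains B where "\<And>h z. h \<in> starlike_class \<psi> \<Longrightarrow> z \<in> ball 0 (1/4) \<Longrightarrow> cmod (deriv (deriv h) z) \<le> B"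
proof -
  have subc: "cball 0 (1/2) \<subseteq> ball (0::complex) 1"
    by auto
  have "continuous_on (cball 0 (1/2)) (deriv \<psi>)"
    using holomorphic_deriv[OF hol open_ball] subc
    by (meson continuous_on_subset holomorphic_on_imp_continuous_on)
  then have "bounded (deriv \<psi> ` cball 0 (1/2))"
    by (intro compact_imp_bounded compact_continuous_image) auto
  then obtain L where L: "\<And>z. z \<in> cball 0 (1/2) \<Longrightarrow> cmod (deriv \<psi> z) \<le> L"
    unfolding bounded_iff by blast
  have \<psi>L: "cmod (\<psi> w - 1) \<le> L * cmod w" if "w \<in> cball 0 (1/2)" for w
  proof -
    have "cmod (\<psi> w - \<psi> 0) \<le> L * cmod (w - 0)"
    proof (rule field_differentiable_bound[OF convex_cball])
      fix z :: complex assume "z \<in> cball 0 (1/2)"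
      then show "(\<psi> has_field_derivative deriv \<psi> z) (at z within cball 0 (1/2))"
        using hol subc by (meson has_field_derivative_at_within holomorphic_derivI open_ball subsetD)
    qed (use L that in auto)
    then show ?thesis by (simp add: \<psi>0)
  qed
  have L0: "0 \<le> L"
    using order_trans[OF norm_ge_zero L[of 0]] by simp
  define K where "K = exp L"
  \<comment> \<open>The constant is \<open>fact 2 / (1/4) ^ 2\<close> from Cauchy's inequality on
    the disc of radius \<open>1/4\<close> about \<open>z\<close>, which stays inside
    \<open>cball 0 (1/2)\<close>, where \<open>K\<close> bounds \<open>h\<close>.\<close>
  have "cmod (deriv (deriv h) z) \<le> 32 * K" if h: "h \<in> starlike_class \<psi>" and z: "z \<in> ball 0 (1/4)" for h z
  proof -
    obtain \<omega> where H: "h holomorphic_on ball 0 1" "h 0 = 0" "deriv h 0 = 1"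
        "\<And>z. z \<in> ball 0 1 \<Longrightarrow> z \<noteq> 0 \<Longrightarrow> h z \<noteq> 0"
      and w: "\<omega> holomorphic_on ball 0 1" "\<And>z. z \<in> ball 0 1 \<Longrightarrow> \<omega> z \<in> ball 0 1" "\<omega> 0 = 0"
        "\<And>z. z \<in> ball 0 1 \<Longrightarrow> cmod (\<omega> z) \<le> cmod z"
      and eq: "\<And>z. z \<in> ball 0 1 \<Longrightarrow> z * deriv h z = \<psi> (\<omega> z) * h z"
      by (rule starlike_classE[OF h]) (rule that; blast)
    have p0: "(\<psi> \<circ> \<omega>) 0 = 1"
      using w(3) \<psi>0 by simp
    have holp: "\<psi> \<circ> \<omega> holomorphic_on ball 0 1"
      using w(2) by (intro holomorphic_on_compose_gen[OF w(1) hol]) auto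
    obtain Q where Q: "Q holomorphic_on ball 0 1" "Q 0 = 0" "deriv Q 0 = deriv (\<psi> \<circ> \<omega>) 0"
        "\<And>z. z \<in> ball 0 1 \<Longrightarrow> z * deriv Q z = (\<psi> \<circ> \<omega>) z - 1"
      by (rule starlike_exponent[OF holp p0]) (rule that; blast)
    have he: "h z = z * exp (Q z)" if "z \<in> ball 0 1" for z
      using starlike_eq_exp[OF H(1-3) Q(1,2) _ that] eq Q(4) by simp
    have QL: "cmod (deriv Q x) \<le> L" if x: "x \<in> cball 0 (1/2)" for x
    proof (cases "x = 0")
      case True
      \<comment> \<open>At the origin the equation for \<open>Q\<close> carries no information, so
        the bound comes from the chain rule and
        \<open>cmod (deriv \<omega> 0) \<le> 1\<close>.\<close>
      have "deriv (\<psi> \<circ> \<omega>) 0 = deriv \<psi> 0 * deriv \<omega> 0"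
        using deriv_chain[of \<omega> 0 \<psi>] w(3) holomorphic_on_imp_differentiable_at[OF w(1) open_ball, of 0]
          holomorphic_on_imp_differentiable_at[OF hol open_ball, of 0] by simp
      moreover have "cmod (deriv \<omega> 0) \<le> 1"
        using Schwarz_Lemma(2)[OF w(1,3), of 0] w(2) by auto
      ultimately have "cmod (deriv Q 0) \<le> cmod (deriv \<psi> 0)"
        by (simp add: Q(3) norm_mult mult_left_le)
      with L[of 0] True show ?thesis by simp
    next
      case False
      have x1: "x \<in> ball 0 1" using x subc by blast
      have "cmod x * cmod (deriv Q x) = cmod (\<psi> (\<omega> x) - 1)"
        using Q(4)[OF x1] by (metis comp_apply norm_mult)
      also have "\<dots> \<le> L * cmod (\<omega> x)"
        using w(4)[OF x1] x by (intro \<psi>L) auto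
      also have "\<dots> \<le> cmod x * L"
        using mult_left_mono[OF w(4)[OF x1] L0] by (simp add: mult.commute)
      finally show ?thesis using False by simp
    qed
    have hK: "cmod (h x) \<le> K" if x: "x \<in> cball 0 (1/2)" for x
    proof -
      have "cmod (Q x - Q 0) \<le> L * cmod (x - 0)"
      proof (rule field_differentiable_bound[OF convex_cball])
        fix y :: complex assume "y \<in> cball 0 (1/2)"
        then show "(Q has_field_derivative deriv Q y) (at y within cball 0 (1/2))"
          using Q(1) subc by (meson has_field_derivative_at_within holomorphic_derivI open_ball subsetD)
      qed (use QL that in auto)
      also have "\<dots> \<le> L"
        using x L0 by (intro mult_left_le) auto
      finally have "cmod (exp (Q x)) \<le> K"
        using norm_exp[of "Q x"] Q(2) by (simp add: K_def)
      then have "cmod x * cmod (exp (Q x)) \<le> 1 * K"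
        using x by (intro mult_mono) auto
      then show ?thesis
        using he[of x] x subc by (auto simp: norm_mult)
    qed
    have "cball z (1/4) \<subseteq> cball 0 (1/2)"
      using z by (subst cball_subset_cball_iff) auto
    then have zK: "cmod (h x) \<le> K" and zs: "x \<in> ball 0 1" if "x \<in> cball z (1/4)" for x
      using hK that subc by blast+
    have "cmod ((deriv ^^ 2) h z) \<le> fact 2 * K / (1/4) ^ 2"
    proof (rule Cauchy_inequality)
      show "h holomorphic_on ball z (1/4)" "continuous_on (cball z (1/4)) h"
        using zs by (auto intro: holomorphic_on_subset[OF H(1)] continuous_on_subset[OF holomorphic_on_imp_continuous_on[OF H(1)]])
    qed (use zK in \<open>auto simp: dist_norm\<close>)
    then show ?thesis
      by (simp add: eval_nat_numeral)
  qed
  then show ?thesis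
    using that by blast
qed

text \<open>Any two points lie in a common admissible smaller ball, so injectivity and convexity
  pass to the union. This shows that a supremum of admissible radii is admissible.\<close>

lemma convex_on_increasing_balls:
  fixes h :: "'a::real_normed_vector \<Rightarrow> 'b::real_vector"
  assumes "\<And>z::'a. norm z < \<rho> \<Longrightarrow> \<exists>r. norm z < r \<and> r \<le> \<rho> \<and> inj_on h (ball 0 r) \<and> convex (h ` ball 0 r)"
  shows "inj_on h (ball 0 \<rho>) \<and> convex (h ` ball 0 \<rho>)"
proof
  have *: "\<exists>r\<le>\<rho>. norm x < r \<and> norm y < r \<and> inj_on h (ball 0 r) \<and> convex (h ` ball 0 r)"
    if "norm x < \<rho>" "norm y < \<rho>" for x y :: 'a
    using assms[OF that(1)] assms[OF that(2)] by (cases "norm x \<le> norm y") (force dest: le_less_trans)+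
  show "inj_on h (ball 0 \<rho>)"
  proof (rule inj_onI)
    fix x y assume "x \<in> ball 0 \<rho>" "y \<in> ball 0 \<rho>" "h x = h y"
    then show "x = y" using *[of x y] by (auto dest: inj_onD)
  qed
  show "convex (h ` ball 0 \<rho>)"
  proof (rule convexI, clarify)
    fix x y :: 'a and u v :: real
    assume "x \<in> ball 0 \<rho>" "y \<in> ball 0 \<rho>" and uv: "0 \<le> u" "0 \<le> v" "u + v = 1"
    then obtain r where r: "r \<le> \<rho>" "norm x < r" "norm y < r" "convex (h ` ball 0 r)"
      using *[of x y] by auto
    then have "u *\<^sub>R h x + v *\<^sub>R h y \<in> h ` ball 0 r"
      using uv by (intro convexD) auto
    with r(1) show "u *\<^sub>R h x + v *\<^sub>R h y \<in> h ` ball 0 \<rho>"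
      by auto
  qed
qed

text \<open>The \<open>GREATEST\<close> in the definition is meaningful: the admissible radii are bounded, closed
  under suprema, and nonempty.\<close>

lemma radius_of_convexity_works:
  assumes hol: "\<psi> holomorphic_on ball 0 1" and \<psi>0: "\<psi> 0 = 1"
  defines "\<rho> \<equiv> radius_of_convexity (starlike_class \<psi>)"
  shows "0 < \<rho>" "\<rho> \<le> 1"
    and "\<And>h. h \<in> starlike_class \<psi> \<Longrightarrow> inj_on h (ball 0 \<rho>) \<and> convex (h ` ball 0 \<rho>)"
proof -
  define P where "P r \<longleftrightarrow> 0 < r \<and> r \<le> 1 \<and>
    (\<forall>h\<in>starlike_class \<psi>. inj_on h (ball 0 r) \<and> convex (h ` ball 0 r))" for r
  obtain B0 where B0: "\<And>h z. h \<in> starlike_class \<psi> \<Longrightarrow> z \<in> ball 0 (1/4) \<Longrightarrow> cmod (deriv (deriv h) z) \<le> B0"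
    by (rule starlike_class_deriv2_bounded[OF hol \<psi>0]) (rule that; blast)
  \<comment> \<open>The maximum with \<open>1\<close> makes \<open>B\<close> positive and keeps the
    radius \<open>1 / (4 * B)\<close> within \<open>1/4\<close>, where the bound \<open>B0\<close>
    is known.\<close>
  define B where "B = max 1 B0"
  have "P (1 / (4 * B))"
  proof -
    have r: "0 < 1 / (4 * B)" "1 / (4 * B) \<le> 1/4" "4 * B * (1 / (4 * B)) \<le> 1"
      by (auto simp: B_def field_simps)
    have "inj_on h (ball 0 (1 / (4 * B))) \<and> convex (h ` ball 0 (1 / (4 * B)))"
      if h: "h \<in> starlike_class \<psi>" for h
    proof -
      have "h holomorphic_on ball 0 1" and h1: "deriv h 0 = 1"
        using h by (auto simp: starlike_class_def normalized_analytic_def)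
      then have "h holomorphic_on ball 0 (1 / (4 * B))"
        using r(2) by (elim holomorphic_on_subset) auto
      moreover have "cmod (deriv (deriv h) z) \<le> B" if "z \<in> ball 0 (1 / (4 * B))" for z
      proof -
        have "cmod z < 1/4"
          using that r(2) by (simp only: mem_ball_0)
        then show ?thesis
          using B0[OF h, of z] by (simp add: B_def le_max_iff_disj)
      qed
      ultimately show ?thesis
        using small_disc_image_convex[OF _ h1] r(1,3) by blast
    qed
    with r show ?thesis by (auto simp: P_def)
  qed
  then have ne: "Collect P \<noteq> {}" by blast
  have bdd: "bdd_above (Collect P)"
    by (auto simp: P_def)
  define s where "s = Sup (Collect P)"
  have up: "r \<le> s" if "P r" for r
    unfolding s_def using that bdd by (auto intro: cSup_upper)
  have Ps: "P s"
  proof -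
    have "0 < s" using up \<open>P (1 / (4 * B))\<close> unfolding P_def by (meson less_le_trans)
    moreover have "s \<le> 1"
      unfolding s_def using ne by (intro cSup_least) (auto simp: P_def)
    moreover have "inj_on h (ball 0 s) \<and> convex (h ` ball 0 s)" if h: "h \<in> starlike_class \<psi>" for h
    proof (rule convex_on_increasing_balls)
      fix z :: complex assume "cmod z < s"
      then obtain r where "P r" "cmod z < r"
        unfolding s_def using less_cSup_iff[OF ne bdd] by auto
      then show "\<exists>r. cmod z < r \<and> r \<le> s \<and> inj_on h (ball 0 r) \<and> convex (h ` ball 0 r)"
        using up[of r] h by (intro exI[of _ r]) (auto simp: P_def)
    qed
    ultimately show ?thesis by (auto simp: P_def)
  qed
  have "\<rho> = s"
    unfolding \<rho>_def radius_of_convexity_def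
    using Greatest_equality[of P s] Ps up by (simp add: P_def[abs_def])
  with Ps show "0 < \<rho>" "\<rho> \<le> 1"
      "\<And>h. h \<in> starlike_class \<psi> \<Longrightarrow> inj_on h (ball 0 \<rho>) \<and> convex (h ` ball 0 \<rho>)"
    by (auto simp: P_def)
qed

subsection \<open>The minimum modulus and the extremal functions\<close>

lemma circle_min_le:
  assumes "z \<in> sphere 0 r"
  shows "circle_min \<psi> r \<le> cmod (\<psi> z)"
  unfolding circle_min_def using assms by (intro cINF_lower) (auto intro!: bdd_belowI[of _ 0])

text \<open>The maximum modulus principle for \<open>1 / \<psi>\<close>; this is where \<open>\<psi>\<close> must not vanish.\<close>

lemma circle_min_le_disc:
  assumes hol: "\<psi> holomorphic_on ball 0 1" and nz: "\<And>z. z \<in> ball 0 1 \<Longrightarrow> \<psi> z \<noteq> 0"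
    and r: "r < 1" and z: "cmod z \<le> r"
  shows "circle_min \<psi> r \<le> cmod (\<psi> z)" and "0 < circle_min \<psi> r"
proof -
  have r0: "0 \<le> r" using z order_trans[OF norm_ge_zero] by blast
  have sub: "cball 0 r \<subseteq> ball (0::complex) 1" using r by auto
  have cont: "continuous_on (cball 0 r) \<psi>"
    using hol sub by (meson continuous_on_subset holomorphic_on_imp_continuous_on)
  obtain w where w: "w \<in> sphere 0 r" "circle_min \<psi> r = cmod (\<psi> w)"
    using circle_min_attained[of r \<psi>] cont r0 by (meson continuous_on_subset sphere_cball)
  have w1: "w \<in> ball 0 1"
    using w(1) sub by auto
  show pos: "0 < circle_min \<psi> r"
    using w nz[OF w1] by simp
  have "cmod (inverse (\<psi> z)) \<le> inverse (circle_min \<psi> r)"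
  proof (rule maximum_modulus_frontier[where S = "cball 0 r" and f = "\<lambda>z. inverse (\<psi> z)"])
    show "(\<lambda>z. inverse (\<psi> z)) holomorphic_on interior (cball 0 r)"
      using r nz by (intro holomorphic_intros holomorphic_on_subset[OF hol]) auto
    show "continuous_on (closure (cball 0 r)) (\<lambda>z. inverse (\<psi> z))"
      using cont nz sub by (auto intro!: continuous_on_inverse)
    show "cmod (inverse (\<psi> x)) \<le> inverse (circle_min \<psi> r)" if "x \<in> frontier (cball 0 r)" for x
      using that pos circle_min_le[of x r \<psi>] by (auto simp: norm_inverse intro!: le_imp_inverse_le)
  qed (use z in auto)
  then show "circle_min \<psi> r \<le> cmod (\<psi> z)"
    using pos nz[of z] z r by (simp add: norm_inverse)
qed

lemma circle_min_antimono:
  assumes "\<psi> holomorphic_on ball 0 1" and "\<And>z. z \<in> ball 0 1 \<Longrightarrow> \<psi> z \<noteq> 0"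
    and "0 \<le> r" "r \<le> s" "s < 1"
  shows "circle_min \<psi> s \<le> circle_min \<psi> r"
proof -
  have "complex_of_real r \<in> sphere 0 r"
    using assms(3) by simp
  then show ?thesis
    unfolding circle_min_def[of \<psi> r]
    using circle_min_le_disc(1)[OF assms(1,2,5)] assms(4) by (intro cINF_greatest) auto
qed

text \<open>Points with the same argument on the circles of radii \<open>r\<close> and
  \<open>s\<close> are at distance \<open>dist s r\<close>, so uniform continuity of
  \<open>\<psi>\<close> on the closed disc transfers to the minima.\<close>

lemma circle_min_continuous:
  assumes hol: "\<psi> holomorphic_on ball 0 1" and b: "b < 1"
  shows "continuous_on {0..b} (circle_min \<psi>)"
proof (cases "0 \<le> b")
  case True
  have sub: "cball 0 b \<subseteq> ball (0::complex) 1" using b by auto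
  have "continuous_on (cball 0 b) \<psi>"
    using hol sub by (meson continuous_on_subset holomorphic_on_imp_continuous_on)
  then have "uniformly_continuous_on (cball 0 b) \<psi>"
    by (intro compact_uniformly_continuous) auto
  then have uc: "\<exists>d>0. \<forall>x\<in>cball 0 b. \<forall>y\<in>cball 0 b. dist y x < d \<longrightarrow> cmod (\<psi> y - \<psi> x) < e" if "0 < e" for e
    using that unfolding uniformly_continuous_on_def by (simp add: dist_norm)
  have half: "circle_min \<psi> s \<le> circle_min \<psi> r + e"
    if d: "\<And>x y. x \<in> cball 0 b \<Longrightarrow> y \<in> cball 0 b \<Longrightarrow> dist y x < d \<Longrightarrow> cmod (\<psi> y - \<psi> x) < e"
      and rs: "r \<in> {0..b}" "s \<in> {0..b}" "dist s r < d" for r s d e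
  proof -
    have "circle_min \<psi> s - e \<le> circle_min \<psi> r"
      unfolding circle_min_def[of \<psi> r]
    proof (rule cINF_greatest)
      have "complex_of_real r \<in> sphere 0 r" using rs by simp
      then show "sphere 0 r \<noteq> ({} :: complex set)" by blast
      fix x :: complex assume x: "x \<in> sphere 0 r"
      define y where "y = of_real s * cis (Arg x)"
      have x': "x = of_real r * cis (Arg x)"
        using x rcis_cmod_Arg[of x] by (simp add: rcis_def)
      have "y - x = of_real (s - r) * cis (Arg x)"
        by (subst x') (simp add: y_def algebra_simps)
      then have "dist y x = dist s r"
        by (simp add: dist_norm norm_mult flip: of_real_diff)
      moreover have "y \<in> sphere 0 s"
        using rs by (simp add: y_def norm_mult)
      ultimately show "circle_min \<psi> s - e \<le> cmod (\<psi> x)"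
        using d[of x y] x rs circle_min_le[of y s \<psi>] norm_triangle_sub[of "\<psi> y" "\<psi> x"] by auto
    qed
    then show ?thesis by simp
  qed
  show ?thesis
    unfolding continuous_on_iff
  proof (intro ballI allI impI)
    fix r e :: real assume r: "r \<in> {0..b}" and e: "0 < e"
    obtain d where d: "0 < d" "\<And>x y. x \<in> cball 0 b \<Longrightarrow> y \<in> cball 0 b \<Longrightarrow> dist y x < d \<Longrightarrow> cmod (\<psi> y - \<psi> x) < e/2"
      using uc[of "e/2"] e by auto
    have "dist (circle_min \<psi> s) (circle_min \<psi> r) < e" if s: "s \<in> {0..b}" "dist s r < d" for s
    proof -
      have "circle_min \<psi> s \<le> circle_min \<psi> r + e/2" "circle_min \<psi> r \<le> circle_min \<psi> s + e/2"
        using half[OF d(2)] r s by (auto simp: dist_commute)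
      then show ?thesis using e by (simp add: dist_norm abs_le_iff)
    qed
    then show "\<exists>d>0. \<forall>s\<in>{0..b}. dist s r < d \<longrightarrow> dist (circle_min \<psi> s) (circle_min \<psi> r) < e"
      using d(1) by blast
  qed
qed simp

section \<open>The equation defining \<open>r_psi\<close>\<close>

text \<open>Both factors of the product are nonnegative and decrease weakly, and
  \<open>- 2 * r\<close> makes the decrease strict. This fixes the sign on each side of the root:
  positive before it, for sense-preservation, and negative after it, for sharpness.\<close>

lemma r_psi_function_strict_antimono:
  assumes "\<psi> holomorphic_on ball 0 1" and "\<And>z. z \<in> ball 0 1 \<Longrightarrow> \<psi> z \<noteq> 0"
    and "0 \<le> r" "r < s" "s < 1"
  shows "(1 - s\<^sup>2) * circle_min \<psi> s - 2 * s < (1 - r\<^sup>2) * circle_min \<psi> r - 2 * r"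
proof -
  have "circle_min \<psi> s \<le> circle_min \<psi> r" "0 < circle_min \<psi> s"
    using circle_min_antimono[OF assms(1,2), of r s] circle_min_le_disc(2)[OF assms(1,2), of s 0] assms by auto
  moreover have "1 - s\<^sup>2 \<le> 1 - r\<^sup>2" "0 \<le> 1 - s\<^sup>2"
    using assms(3-5) by (auto intro!: power_mono power_le_one)
  ultimately have "(1 - s\<^sup>2) * circle_min \<psi> s \<le> (1 - r\<^sup>2) * circle_min \<psi> r"
    by (intro mult_mono) auto
  with assms(4) show ?thesis by linarith
qed

text \<open>The left side equals \<open>1\<close> at \<open>0\<close>. At \<open>1/2\<close> it is
  at most \<open>3/4 - 1\<close>, since the minimum there is at most its value \<open>1\<close> at
  \<open>0\<close>. So the root is found in \<open>{0..1/2}\<close> without looking at the boundary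
  behaviour of \<open>\<psi>\<close>.\<close>

lemma r_psi_root_ex1:
  assumes hol: "\<psi> holomorphic_on ball 0 1" and \<psi>0: "\<psi> 0 = 1"
    and nz: "\<And>z. z \<in> ball 0 1 \<Longrightarrow> \<psi> z \<noteq> 0"
  shows "\<exists>!r. r_psi_root \<psi> r"
proof -
  define F where "F r = (1 - r\<^sup>2) * circle_min \<psi> r - 2 * r" for r
  have anti: "F s < F r" if "0 \<le> r" "r < s" "s < 1" for r s
    unfolding F_def using r_psi_function_strict_antimono[OF hol nz] that by blast
  have m0: "circle_min \<psi> 0 = 1"
    by (simp add: circle_min_def \<psi>0)
  have "circle_min \<psi> (1/2) \<le> 1"
    using circle_min_antimono[OF hol nz, of 0 "1/2"] m0 by simp
  then have "F (1/2) \<le> 0"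
    by (simp add: F_def power2_eq_square)
  moreover have "continuous_on {0..1/2} F"
    unfolding F_def using circle_min_continuous[OF hol, of "1/2"] by (intro continuous_intros) auto
  ultimately obtain r where r: "0 \<le> r" "r \<le> 1/2" "F r = 0"
    using IVT2'[of F "1/2" 0 0] m0 by (auto simp: F_def)
  have "r \<noteq> 0" using r(3) m0 by (auto simp: F_def)
  with r have "r_psi_root \<psi> r"
    by (simp add: r_psi_root_def F_def)
  moreover have "s = t" if "r_psi_root \<psi> s" "r_psi_root \<psi> t" for s t
    using that anti[of s t] anti[of t s] by (cases s t rule: linorder_cases) (auto simp: r_psi_root_def F_def)
  ultimately show ?thesis by blast
qed

section \<open>Sense-preservation inside the disc of radius \<open>r_psi\<close>\<close>

text \<open>The estimate is made on the circle through \<open>z\<close>, of radius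
  \<open>t < r\<close>, where strict monotonicity gives \<open>2 * t < (1 - t\<^sup>2) * m\<close>.
  This is the source of the strict inequality.\<close>

lemma sense_preserving_on_product:
  assumes hol: "\<psi> holomorphic_on ball 0 1" and nz: "\<And>z. z \<in> ball 0 1 \<Longrightarrow> \<psi> z \<noteq> 0"
    and root: "r_psi_root \<psi> r" and h: "h \<in> starlike_class \<psi>" and \<phi>: "\<phi> \<in> schwarz_class"
  shows "sense_preserving_on h (\<lambda>z. \<phi> z * h z) (ball 0 r)"
  unfolding sense_preserving_on_def
proof
  fix z :: complex assume "z \<in> ball 0 r"
  then have z: "cmod z < r" by simp
  define t where "t = cmod z"
  have r: "0 < r" "r < 1" "(1 - r\<^sup>2) * circle_min \<psi> r - 2 * r = 0"
    using root by (auto simp: r_psi_root_def)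
  have t: "0 \<le> t" "t < r" "t < 1"
    using z r by (auto simp: t_def)
  have z1: "z \<in> ball 0 1" using z r by simp
  define m where "m = circle_min \<psi> t"
  have m: "0 < m" "2 * t < (1 - t\<^sup>2) * m"
    using r_psi_function_strict_antimono[OF hol nz t(1,2) r(2)] r(3)
      circle_min_le_disc(2)[OF hol nz t(3), of 0] t(1) by (auto simp: m_def)
  have \<phi>': "\<phi> holomorphic_on ball 0 1" "\<phi> ` ball 0 1 \<subseteq> ball 0 1"
    using \<phi> by (auto simp: schwarz_class_def)
  define b where "b = cmod (\<phi> z)"
  have b: "0 \<le> b" "b < 1"
    using \<phi>'(2) z1 by (auto simp: b_def image_subset_iff)
  obtain \<omega> where H: "h holomorphic_on ball 0 1" "h 0 = 0" "deriv h 0 = 1"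
        "\<And>z. z \<in> ball 0 1 \<Longrightarrow> z \<noteq> 0 \<Longrightarrow> h z \<noteq> 0"
      and w: "\<omega> holomorphic_on ball 0 1" "\<And>z. z \<in> ball 0 1 \<Longrightarrow> \<omega> z \<in> ball 0 1" "\<omega> 0 = 0"
        "\<And>z. z \<in> ball 0 1 \<Longrightarrow> cmod (\<omega> z) \<le> cmod z"
      and eq: "\<And>z. z \<in> ball 0 1 \<Longrightarrow> z * deriv h z = \<psi> (\<omega> z) * h z"
    by (rule starlike_classE[OF h]) (rule that; blast)
  have "m \<le> cmod (\<psi> (\<omega> z))"
    unfolding m_def using w(4)[OF z1] by (intro circle_min_le_disc(1)[OF hol nz t(3)]) (auto simp: t_def)
  then have hm: "m * cmod (h z) \<le> t * cmod (deriv h z)"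
    using arg_cong[OF eq[OF z1], of cmod] by (simp add: norm_mult t_def mult_right_mono)
  have dh: "deriv h z \<noteq> 0"
    using eq[OF z1] nz[OF w(2)[OF z1]] H(3) H(4)[OF z1] by (cases "z = 0") auto
  have "((\<lambda>z. \<phi> z * h z) has_field_derivative deriv \<phi> z * h z + \<phi> z * deriv h z) (at z)"
    using holomorphic_derivI[OF \<phi>'(1) open_ball z1] holomorphic_derivI[OF H(1) open_ball z1]
    by (auto intro!: derivative_eq_intros)
  then have "cmod (deriv (\<lambda>z. \<phi> z * h z) z) = cmod (deriv \<phi> z * h z + \<phi> z * deriv h z)"
    by (simp add: DERIV_imp_deriv)
  also have "\<dots> \<le> cmod (deriv \<phi> z) * cmod (h z) + b * cmod (deriv h z)"
    by (metis b_def norm_mult norm_triangle_ineq)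
  finally have le: "cmod (deriv (\<lambda>z. \<phi> z * h z) z) \<le> cmod (deriv \<phi> z) * cmod (h z) + b * cmod (deriv h z)" .
  have pt: "0 < 1 - t\<^sup>2" using one_minus_norm_sq_pos[of z] z1 by (simp add: t_def)
  have SP: "cmod (deriv \<phi> z) * (1 - t\<^sup>2) \<le> 1 - b\<^sup>2"
    using Schwarz_Pick_deriv[OF \<phi>', of z] z1 pt by (simp add: t_def b_def field_simps)
  have "(cmod (deriv \<phi> z) * cmod (h z)) * ((1 - t\<^sup>2) * m) = (cmod (deriv \<phi> z) * (1 - t\<^sup>2)) * (m * cmod (h z))"
    by simp
  also have "\<dots> \<le> (1 - b\<^sup>2) * (t * cmod (deriv h z))"
    using SP hm m(1) b by (intro mult_mono[OF SP hm]) (auto simp: power_le_one)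
  \<comment> \<open>Splitting off \<open>1 - b\<close>, exactly the gap to be filled, leaves
    \<open>(1 + b) * t\<close>, which is at most \<open>2 * t\<close> whatever the value of
    \<open>b\<close>.\<close>
  also have "\<dots> = (1 - b) * cmod (deriv h z) * ((1 + b) * t)"
    by (simp add: algebra_simps power2_eq_square)
  also have "\<dots> < (1 - b) * cmod (deriv h z) * ((1 - t\<^sup>2) * m)"
  proof (rule mult_strict_left_mono)
    have "(1 + b) * t \<le> 2 * t" using b t by (intro mult_right_mono) auto
    with m(2) show "(1 + b) * t < (1 - t\<^sup>2) * m" by linarith
    show "0 < (1 - b) * cmod (deriv h z)" using b dh by simp
  qed
  finally have "cmod (deriv \<phi> z) * cmod (h z) < (1 - b) * cmod (deriv h z)"
    using pt m(1) by (simp add: mult_less_cancel_right)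
  with le show "cmod (deriv (\<lambda>z. \<phi> z * h z) z) < cmod (deriv h z)"
    by (simp add: algebra_simps)
qed

section \<open>Sharpness\<close>

text \<open>\<open>N\<close> moves \<open>- r\<close> to \<open>0\<close> and \<open>- M\<close>
  moves \<open>0\<close> to \<open>c\<close>, so Schwarz-Pick is an equality at \<open>- r\<close>.
  The sign makes the derivative negative there; since the extremal \<open>h\<close> has
  \<open>h / h'\<close> negative at \<open>- r\<close>, the two terms of \<open>g' / h'\<close> add
  up.\<close>

lemma exists_schwarz_class_extremal:
  assumes "0 < r" "r < 1" "0 < c" "c < 1"
  obtains \<phi> where "\<phi> \<in> schwarz_class" "\<phi> (- of_real r) = of_real c"
    "(\<phi> has_field_derivative of_real (- (1 - c\<^sup>2) / (1 - r\<^sup>2))) (at (- of_real r))"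
proof -
  define M where "M = Moebius_function 0 (of_real c)"
  define N where "N = Moebius_function 0 (- of_real r)"
  define \<phi> where "\<phi> z = - M (N z)" for z
  have nr: "cmod (- of_real r) < 1" and nc: "cmod (of_real c) < 1"
    using assms by auto
  have N: "N holomorphic_on ball 0 1" "\<And>z. cmod z < 1 \<Longrightarrow> cmod (N z) < 1" "N (- of_real r) = 0"
    using nr by (auto simp: N_def Moebius_function_eq_zero intro!: Moebius_function_holomorphic Moebius_function_norm_lt_1)
  have M: "M holomorphic_on ball 0 1" "\<And>z. cmod z < 1 \<Longrightarrow> cmod (M z) < 1" "M 0 = - of_real c"
    using nc by (auto simp: M_def Moebius_function_of_zero intro!: Moebius_function_holomorphic Moebius_function_norm_lt_1)
  have "M \<circ> N holomorphic_on ball 0 1"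
    using N(2) by (intro holomorphic_on_compose_gen[OF N(1) M(1)]) auto
  then have "\<phi> \<in> schwarz_class"
    unfolding schwarz_class_def \<phi>_def using N(2) M(2) by (auto intro!: holomorphic_intros simp: o_def)
  moreover have "\<phi> (- of_real r) = of_real c"
    by (simp add: \<phi>_def N(3) M(3))
  moreover have "(\<phi> has_field_derivative of_real (- (1 - c\<^sup>2) / (1 - r\<^sup>2))) (at (- of_real r))"
  proof -
    have r2: "1 - complex_of_real r * complex_of_real r \<noteq> 0"
    proof -
      have "1 - r * r \<noteq> 0"
        using assms(1,2) mult_strict_mono[of r 1 r 1] by simp
      then show ?thesis
        by (metis of_real_1 of_real_diff of_real_eq_0_iff of_real_mult)
    qed
    have "(N has_field_derivative (1 - cnj (- of_real r) * (- of_real r)) / (1 - cnj (- of_real r) * (- of_real r))\<^sup>2) (at (- of_real r))"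
      unfolding N_def using r2 by (intro Moebius_function_has_field_derivative) simp
    then have "(N has_field_derivative 1 / (1 - of_real r * of_real r)) (at (- of_real r))"
      using r2 by (simp add: power2_eq_square)
    moreover have "(M has_field_derivative (1 - cnj (of_real c) * of_real c) / (1 - cnj (of_real c) * 0)\<^sup>2) (at (N (- of_real r)))"
      unfolding M_def N(3) by (intro Moebius_function_has_field_derivative) simp
    then have "(M has_field_derivative 1 - of_real c * of_real c) (at (N (- of_real r)))"
      by simp
    ultimately have "((\<lambda>z. - M (N z)) has_field_derivative - ((1 - of_real c * of_real c) * (1 / (1 - of_real r * of_real r)))) (at (- of_real r))"
      by (intro DERIV_minus DERIV_chain2)
    then show ?thesis
      by (simp add: \<phi>_def[abs_def] power2_eq_square minus_divide_left)
  qed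
  ultimately show ?thesis
    using that by blast
qed

text \<open>For the extremal pair, \<open>g' / h'\<close> at \<open>- r\<close> equals
  \<open>(1 - c\<^sup>2) * r / p + c\<close>. This is at least \<open>1\<close> as soon as
  \<open>p \<le> (1 + c) * r\<close>, which \<open>p < 2 * r\<close> allows for some
  \<open>c\<close> below \<open>1\<close>.\<close>

lemma exists_not_sense_preserving:
  assumes hol: "\<psi> holomorphic_on ball 0 1" and \<psi>0: "\<psi> 0 = 1"
    and nz: "\<And>z. z \<in> ball 0 1 \<Longrightarrow> \<psi> z \<noteq> 0"
    and r: "0 < r" "r < 1" and m: "complex_of_real (circle_min \<psi> r) = \<psi> (- complex_of_real r)"
    and lt: "(1 - r\<^sup>2) * circle_min \<psi> r < 2 * r"
  obtains h \<phi> where "h \<in> starlike_class \<psi>" "\<phi> \<in> schwarz_class"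
    "cmod (deriv h (- of_real r)) \<le> cmod (deriv (\<lambda>z. \<phi> z * h z) (- of_real r))"
proof -
  define m' where "m' = circle_min \<psi> r"
  define p where "p = (1 - r\<^sup>2) * m'"
  have p: "0 < m'" "0 < p" "p < 2 * r"
    using circle_min_le_disc(2)[OF hol nz r(2), of 0] lt r
    by (auto simp: m'_def p_def abs_square_less_1)
  \<comment> \<open>\<open>p / r - 1\<close> is the least value with
    \<open>p \<le> (1 + c) * r\<close>, and it is below \<open>1\<close> because
    \<open>p < 2 * r\<close>. The entry \<open>1/2\<close> keeps \<open>c\<close> positive.\<close>
  define c where "c = max (1/2) (p / r - 1)"
  have c: "0 < c" "c < 1" "p \<le> (1 + c) * r"
    using p r by (auto simp: c_def field_simps max_def)
  obtain \<phi> where \<phi>: "\<phi> \<in> schwarz_class" "\<phi> (- of_real r) = of_real c"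
    "(\<phi> has_field_derivative of_real (- (1 - c\<^sup>2) / (1 - r\<^sup>2))) (at (- of_real r))"
    using exists_schwarz_class_extremal[OF r c(1,2)] by blast
  obtain h where h: "h \<in> starlike_class \<psi>" "\<And>z. z \<in> ball 0 1 \<Longrightarrow> z * deriv h z = \<psi> z * h z"
    using exists_starlike[OF hol \<psi>0] by blast
  define a where "a = - complex_of_real r"
  have a1: "a \<in> ball 0 1" using r by (simp add: a_def)
  have holh: "h holomorphic_on ball 0 1"
    using h(1) by (auto simp: starlike_class_def normalized_analytic_def)
  have ha: "h a = of_real (- r / m') * deriv h a"
  proof -
    have "\<psi> a = of_real m'"
      using m by (simp add: a_def m'_def)
    moreover have "complex_of_real m' \<noteq> 0"
      using p(1) by simp
    moreover from calculation have "h a = a * deriv h a / of_real m'"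
      using h(2)[OF a1] by (simp add: eq_divide_eq mult.commute)
    ultimately show ?thesis
      by (simp add: a_def)
  qed
  have "((\<lambda>z. \<phi> z * h z) has_field_derivative of_real (- (1 - c\<^sup>2) / (1 - r\<^sup>2)) * h a + deriv h a * \<phi> a) (at a)"
    using \<phi>(3) holomorphic_derivI[OF holh open_ball a1] unfolding a_def by (rule DERIV_mult)
  then have "deriv (\<lambda>z. \<phi> z * h z) a = of_real (- (1 - c\<^sup>2) / (1 - r\<^sup>2)) * h a + deriv h a * \<phi> a"
    by (rule DERIV_imp_deriv)
  also have "of_real (- (1 - c\<^sup>2) / (1 - r\<^sup>2)) * h a = of_real ((1 - c\<^sup>2) * r / p) * deriv h a"
  proof -
    have "(- (1 - c\<^sup>2) / (1 - r\<^sup>2)) * (- r / m') = (1 - c\<^sup>2) * r / p"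
      by (simp only: p_def times_divide_times_eq minus_mult_minus)
    then show ?thesis
      unfolding ha by (metis mult.assoc of_real_mult)
  qed
  also have "deriv h a * \<phi> a = of_real c * deriv h a"
    using \<phi>(2) by (simp add: a_def)
  also have "of_real ((1 - c\<^sup>2) * r / p) * deriv h a + of_real c * deriv h a =
      of_real ((1 - c\<^sup>2) * r / p + c) * deriv h a"
    by (simp only: of_real_add distrib_right)
  finally have "cmod (deriv (\<lambda>z. \<phi> z * h z) a) = \<bar>(1 - c\<^sup>2) * r / p + c\<bar> * cmod (deriv h a)"
    by (simp only: norm_mult norm_of_real)
  moreover have "1 \<le> (1 - c\<^sup>2) * r / p + c"
  proof -
    have "(1 - c) * p \<le> (1 - c) * ((1 + c) * r)"
      using c by (intro mult_left_mono) auto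
    also have "\<dots> = (1 - c\<^sup>2) * r"
      by (simp add: algebra_simps power2_eq_square)
    finally show ?thesis
      using p(2) by (simp add: field_simps)
  qed
  ultimately have "cmod (deriv h a) \<le> cmod (deriv (\<lambda>z. \<phi> z * h z) a)"
    using mult_right_mono[of 1 "\<bar>(1 - c\<^sup>2) * r / p + c\<bar>" "cmod (deriv h a)"] by simp
  then show ?thesis
    using that h(1) \<phi>(1) unfolding a_def by blast
qed

text \<open>Existence and uniqueness of the root belong to the conclusion because they give the
  \<open>THE\<close> in \<open>r_psi\<close> its meaning. For sharpness, the witnesses already
  violate sense-preservation in the larger disc.\<close>

theorem theorem3:
  fixes \<psi> :: "complex \<Rightarrow> complex" and R :: real
  assumes "\<psi> holomorphic_on ball 0 1"
    and "inj_on \<psi> (ball 0 1)"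
    and "\<psi> 0 = 1"
    and "\<And>z. z \<in> ball 0 1 \<Longrightarrow> 0 < Re (\<psi> z)"
    and "\<And>n. 1 \<le> n \<Longrightarrow> \<exists>p::real. 0 < p \<and> (deriv ^^ n) \<psi> 0 / fact n = complex_of_real p"
    and "R = min (r_psi \<psi>) (radius_of_convexity (starlike_class \<psi>))"
  shows "(\<exists>!r. r_psi_root \<psi> r) \<and>
    (\<forall>h\<in>starlike_class \<psi>. \<forall>\<phi>\<in>schwarz_class.
       sense_preserving_on h (\<lambda>z. \<phi> z * h z) (ball 0 R) \<and>
       inj_on (harmonic_map h (\<lambda>z. \<phi> z * h z)) (ball 0 R)) \<and>
    (r_psi \<psi> \<le> radius_of_convexity (starlike_class \<psi>) \<and>
     (\<forall>r. 0 < r \<and> r < 1 \<longrightarrow> complex_of_real (circle_min \<psi> r) = \<psi> (- complex_of_real r)) \<longrightarrow>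
     (\<forall>R'. R < R' \<and> R' \<le> 1 \<longrightarrow>
       (\<exists>h\<in>starlike_class \<psi>. \<exists>\<phi>\<in>schwarz_class.
          \<not> (sense_preserving_on h (\<lambda>z. \<phi> z * h z) (ball 0 R') \<and>
             inj_on (harmonic_map h (\<lambda>z. \<phi> z * h z)) (ball 0 R')))))"
proof (intro conjI ballI impI allI)
  have nz: "\<psi> z \<noteq> 0" if "z \<in> ball 0 1" for z
    using assms(4)[OF that] by auto
  show ex1: "\<exists>!r. r_psi_root \<psi> r"
    by (rule r_psi_root_ex1[OF assms(1,3) nz])
  then have root: "r_psi_root \<psi> (r_psi \<psi>)"
    unfolding r_psi_def by (rule theI')
  define \<rho> where "\<rho> = radius_of_convexity (starlike_class \<psi>)"
  note \<rho> = radius_of_convexity_works[OF assms(1,3), folded \<rho>_def]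
  have R: "R \<le> r_psi \<psi>" "R \<le> \<rho>"
    using assms(6) by (auto simp: \<rho>_def)
  {
    fix h \<phi> assume h: "h \<in> starlike_class \<psi>" and \<phi>: "\<phi> \<in> schwarz_class"
    show sp: "sense_preserving_on h (\<lambda>z. \<phi> z * h z) (ball 0 R)"
      using sense_preserving_on_product[OF assms(1) nz root h \<phi>] R(1)
      by (auto simp: sense_preserving_on_def)
    have holh: "h holomorphic_on ball 0 \<rho>"
      using h \<rho>(2) holomorphic_on_subset[of h "ball 0 1" "ball 0 \<rho>"]
      by (auto simp: starlike_class_def normalized_analytic_def)
    have hol\<phi>: "\<phi> holomorphic_on ball 0 R"
      using \<phi> R(2) \<rho>(2) holomorphic_on_subset[of \<phi> "ball 0 1" "ball 0 R"]
      by (auto simp: schwarz_class_def)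
    have sub: "ball 0 R \<subseteq> ball (0::complex) \<rho>"
      using R(2) by auto
    show "inj_on (harmonic_map h (\<lambda>z. \<phi> z * h z)) (ball 0 R)"
    proof (rule inj_on_harmonic_map_convex[OF open_ball _ _ _ _ sp])
      show "h holomorphic_on ball 0 R"
        using holh sub by (rule holomorphic_on_subset)
      then show "(\<lambda>z. \<phi> z * h z) holomorphic_on ball 0 R"
        using hol\<phi> by (intro holomorphic_intros)
      show "inj_on h (ball 0 R)"
        using \<rho>(3)[OF h] sub by (auto intro: inj_on_subset)
      \<comment> \<open>Convexity of the image is known at radius \<open>\<rho>\<close> and does not
        pass to subsets by itself, so Study's theorem brings it down to \<open>R\<close>.\<close>
      show "convex (h ` ball 0 R)"
        using convex_image_subball[OF holh _ _ R(2)] \<rho>(3)[OF h] by blast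
    qed
  }
  fix R'
  assume hyp: "r_psi \<psi> \<le> radius_of_convexity (starlike_class \<psi>) \<and>
      (\<forall>r. 0 < r \<and> r < 1 \<longrightarrow> complex_of_real (circle_min \<psi> r) = \<psi> (- complex_of_real r))"
    and R': "R < R' \<and> R' \<le> 1"
  \<comment> \<open>A radius strictly between \<open>R = r_psi \<psi>\<close> and \<open>R'\<close>:
    beyond the root, so the defining expression is negative, yet with \<open>- r\<close> still
    inside the larger disc.\<close>
  define r where "r = (R + R') / 2"
  have "R = r_psi \<psi>"
    using hyp assms(6) by simp
  then have r: "0 < r" "r < 1" "r < R'" "r_psi \<psi> < r"
    using R' root by (auto simp: r_def r_psi_root_def)
  have "(1 - r\<^sup>2) * circle_min \<psi> r < 2 * r"
    using r_psi_function_strict_antimono[OF assms(1) nz _ r(4,2)] root by (auto simp: r_psi_root_def)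
  then obtain h \<phi> where "h \<in> starlike_class \<psi>" "\<phi> \<in> schwarz_class"
    "cmod (deriv h (- of_real r)) \<le> cmod (deriv (\<lambda>z. \<phi> z * h z) (- of_real r))"
    using exists_not_sense_preserving[OF assms(1,3) nz r(1,2)] hyp r by blast
  moreover have "- complex_of_real r \<in> ball 0 R'"
    using r by simp
  ultimately show "\<exists>h\<in>starlike_class \<psi>. \<exists>\<phi>\<in>schwarz_class.
      \<not> (sense_preserving_on h (\<lambda>z. \<phi> z * h z) (ball 0 R') \<and>
         inj_on (harmonic_map h (\<lambda>z. \<phi> z * h z)) (ball 0 R'))"
    unfolding sense_preserving_on_def by (meson not_less)
qed

end
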